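(* Let $F$ be a gauge on $\mathbb{R}^2$ that is smooth on $\mathbb{R}^2\setminus\{0\}$ and whose unit circle $S=\{x:F(x)=1\}$ is smooth and strictly convex. Let $\gamma(\tau)=(\gamma_1(\tau),\gamma_2(\tau))$ be an oriented smooth regular curve in $(\mathbb{R}^2,F)$ with arbitrary parameter $\tau$, and let $'$ denote $d/d\tau$. Then the Minkowski curvature of $\gamma$ is $$k_m=\frac{\gamma_1'\gamma_2''-\gamma_1''\gamma_2'}{(F(\gamma_1',\gamma_2'))^3}.$$
   Context: A gauge on $\mathbb{R}^2$ is a function $F:\mathbb{R}^2\to\mathbb{R}$ with $F(x)\ge 0$, $F(x)=0\Leftrightarrow x=0$; $F(\lambda x)=\lambda F(x)$ for $\lambda>0$; $F(x+y)\le F(x)+F(y)$ (no symmetry assumed). For $x=(x_1,x_2)$, $y=(y_1,y_2)$ put $[x,y]=x_1y_2-x_2y_1$. Minkowski curvature: let $s$ be the arc-length parameter of $\gamma$, $ds/d\tau=F(\gamma'(\tau))$, so that $F(d\gamma/ds)=1$. Let $\varphi(t)$ be a counter-clockwise parametrization of $S$ with $[\varphi(t),\varphi'(t)]>0$, put $u(t)=\int_{t_0}^t[\varphi(\rho),\varphi'(\rho)]\,d\rho$, and reparametrize $S$ by $u$ as $\varphi(u)$ (so $[\varphi(u),\varphi'(u)]=1$). Write $\frac{d\gamma}{ds}(s)=\varphi(u(s))$ with $u(s)$ continuous. Then $k_m:=du/ds$, evaluated at the corresponding point of the curve. *)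

theory Defs
  imports "HOL-Analysis.Analysis"
begin

(* S is meant to be an open set or a nondegenerate interval of reals, where derivatives within S
   are unique. On real ^ 'n, continuity of all iterated directional derivatives of order \<le> k is
   the usual class C^k; at end points of an interval the derivatives are one-sided. *)
primrec Ck_on :: "nat \<Rightarrow> ('a::euclidean_space \<Rightarrow> 'b::real_normed_vector) \<Rightarrow> 'a set \<Rightarrow> bool" where
  "Ck_on 0 f S \<longleftrightarrow> continuous_on S f"
| "Ck_on (Suc k) f S \<longleftrightarrow>
     (\<exists>f'. (\<forall>x\<in>S. (f has_derivative f' x) (at x within S)) \<and> (\<forall>v. Ck_on k (\<lambda>x. f' x v) S))"

definition smooth_on :: "('a::euclidean_space \<Rightarrow> 'b::real_normed_vector) \<Rightarrow> 'a set \<Rightarrow> bool" where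
  "smooth_on f S \<longleftrightarrow> (\<forall>k. Ck_on k f S)"

definition plane_gauge :: "(real ^ 2 \<Rightarrow> real) \<Rightarrow> bool" where
  "plane_gauge F \<longleftrightarrow>
     (\<forall>x. F x \<ge> 0) \<and> (\<forall>x. F x = 0 \<longleftrightarrow> x = 0) \<and>
     (\<forall>l x. l > 0 \<longrightarrow> F (l *\<^sub>R x) = l * F x) \<and>
     (\<forall>x y. F (x + y) \<le> F x + F y)"

definition unit_circle :: "(real ^ 2 \<Rightarrow> real) \<Rightarrow> (real ^ 2) set" where
  "unit_circle F = {x. F x = 1}"

definition bracket :: "real ^ 2 \<Rightarrow> real ^ 2 \<Rightarrow> real" where
  "bracket x y = x $ 1 * y $ 2 - x $ 2 * y $ 1"

(* A smooth embedded one-dimensional submanifold of the plane. *)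
definition smooth_plane_curve :: "(real ^ 2) set \<Rightarrow> bool" where
  "smooth_plane_curve S \<longleftrightarrow>
     (\<forall>p\<in>S. \<exists>U c c_inv. open U \<and> p \<in> U \<and> smooth_on c {-1<..<1::real} \<and>
        (\<forall>t\<in>{-1<..<1}. vector_derivative c (at t) \<noteq> 0) \<and>
        homeomorphism {-1<..<1} (S \<inter> U) c c_inv)"

(* Strict convexity of the curve F = 1, i.e. of the ball F \<le> 1 that it bounds: open chords lie in
   the open ball. This does not require positive curvature. *)
definition strictly_convex_unit_circle :: "(real ^ 2 \<Rightarrow> real) \<Rightarrow> bool" where
  "strictly_convex_unit_circle F \<longleftrightarrow>
     (\<forall>x\<in>unit_circle F. \<forall>y\<in>unit_circle F. x \<noteq> y \<longrightarrow> (\<forall>z\<in>open_segment x y. F z < 1))"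

(* The parameter interval I need not be open. *)
definition smooth_regular_curve :: "real set \<Rightarrow> (real \<Rightarrow> real ^ 2) \<Rightarrow> bool" where
  "smooth_regular_curve I \<gamma> \<longleftrightarrow>
     is_interval I \<and> (\<exists>a\<in>I. \<exists>b\<in>I. a < b) \<and> smooth_on \<gamma> I \<and>
     (\<forall>\<tau>\<in>I. vector_derivative \<gamma> (at \<tau> within I) \<noteq> 0)"

(* The closed curve S is traversed by a periodic map defined on the whole line, once per period. *)
definition ccw_parametrization :: "(real ^ 2) set \<Rightarrow> (real \<Rightarrow> real ^ 2) \<Rightarrow> bool" where
  "ccw_parametrization S \<phi> \<longleftrightarrow>
     smooth_on \<phi> UNIV \<and> range \<phi> = S \<and>
     (\<exists>T>0. (\<forall>t. \<phi> (t + T) = \<phi> t) \<and> inj_on \<phi> {0..<T}) \<and>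
     (\<forall>t. bracket (\<phi> t) (vector_derivative \<phi> (at t)) > 0)"

definition sector_param :: "(real \<Rightarrow> real ^ 2) \<Rightarrow> real \<Rightarrow> real \<Rightarrow> real" where
  "sector_param \<phi> t0 t =
     (LBINT \<rho>=ereal t0..ereal t. bracket (\<phi> \<rho>) (vector_derivative \<phi> (at \<rho>)))"

(* For a counter-clockwise parametrization, sector_param \<phi> t0 is an increasing bijection of the
   real line, by periodicity. *)
definition reparam_by_sector :: "(real \<Rightarrow> real ^ 2) \<Rightarrow> real \<Rightarrow> real \<Rightarrow> real ^ 2" where
  "reparam_by_sector \<phi> t0 = \<phi> \<circ> inv (sector_param \<phi> t0)"

definition arc_length_param ::
  "(real ^ 2 \<Rightarrow> real) \<Rightarrow> real set \<Rightarrow> (real \<Rightarrow> real ^ 2) \<Rightarrow> (real \<Rightarrow> real) \<Rightarrow> bool" where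
  "arc_length_param F I \<gamma> s \<longleftrightarrow>
     (\<forall>\<tau>\<in>I. (s has_real_derivative F (vector_derivative \<gamma> (at \<tau> within I))) (at \<tau> within I))"

(* \<gamma> \<circ> inv_into I s, defined on s ` I, is the curve as a function of arc length, and u is a continuous
   function of arc length that locates its unit tangent on the unit circle. *)
definition tangent_lift ::
  "(real ^ 2 \<Rightarrow> real) \<Rightarrow> real set \<Rightarrow> (real \<Rightarrow> real ^ 2) \<Rightarrow> (real \<Rightarrow> real) \<Rightarrow>
   (real \<Rightarrow> real ^ 2) \<Rightarrow> real \<Rightarrow> (real \<Rightarrow> real) \<Rightarrow> bool" where
  "tangent_lift F I \<gamma> s \<phi> t0 u \<longleftrightarrow>
     arc_length_param F I \<gamma> s \<and> ccw_parametrization (unit_circle F) \<phi> \<and>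
     continuous_on (s ` I) u \<and>
     (\<forall>\<sigma>\<in>s ` I. vector_derivative (\<gamma> \<circ> inv_into I s) (at \<sigma> within s ` I)
                  = reparam_by_sector \<phi> t0 (u \<sigma>))"

(* The curvature is k when the data defining du/ds exist and du/ds = k for every choice of them. *)
definition has_minkowski_curvature ::
  "(real ^ 2 \<Rightarrow> real) \<Rightarrow> real set \<Rightarrow> (real \<Rightarrow> real ^ 2) \<Rightarrow> real \<Rightarrow> real \<Rightarrow> bool" where
  "has_minkowski_curvature F I \<gamma> \<tau> k \<longleftrightarrow>
     (\<exists>s \<phi> t0 u. tangent_lift F I \<gamma> s \<phi> t0 u) \<and>
     (\<forall>s \<phi> t0 u. tangent_lift F I \<gamma> s \<phi> t0 u \<longrightarrow>
        (u has_real_derivative k) (at (s \<tau>) within s ` I))"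

end

theory Submission
  imports Defs
begin

text \<open>Let \<open>\<psi>(u)\<close> be the unit circle in its sector parametrization, so \<open>[\<psi>, \<psi>'] = 1\<close>, and let
  \<open>T = \<gamma>' / F(\<gamma>')\<close> be the unit tangent. Differentiating \<open>T(s) = \<psi>(u(s))\<close> and taking the bracket
  with \<open>T\<close> gives \<open>du/ds = [T, dT/ds]\<close>. Since the part of \<open>dT/ds\<close> parallel to \<open>\<gamma>'\<close> drops out of the
  bracket, this equals \<open>[\<gamma>', \<gamma>''] / F(\<gamma>')\<^sup>3\<close>. As \<open>u\<close> is only assumed continuous, its
  differentiability has to be proved: \<open>[\<psi>(u\<^sub>0), \<psi>(u)]\<close> is a differentiable coordinate on the circle
  near \<open>\<psi>(u\<^sub>0)\<close>, with derivative \<open>1\<close> in \<open>u\<close> there. A lift exists because the circle has the polar parametrization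
  \<open>e(t) / F(e(t))\<close> with \<open>e(t) = (cos t, sin t)\<close>, and a continuous nowhere vanishing planar function
  on an interval has a continuous polar angle.\<close>

subsection \<open>Calculus of \<open>C\<^sup>k\<close> functions\<close>

lemma Ck_on_SucI:
  assumes "\<And>x. x \<in> S \<Longrightarrow> (f has_derivative f' x) (at x within S)"
    and "\<And>v. Ck_on k (\<lambda>x. f' x v) S"
  shows "Ck_on (Suc k) f S"
  using assms by auto

lemma Ck_on_SucE:
  assumes "Ck_on (Suc k) f S"
  obtains f' where "\<And>x. x \<in> S \<Longrightarrow> (f has_derivative f' x) (at x within S)"
    and "\<And>v. Ck_on k (\<lambda>x. f' x v) S"
  using assms by auto

lemma Ck_on_Suc_imp: "Ck_on (Suc k) f S \<Longrightarrow> Ck_on k f S"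
proof (induction k arbitrary: f)
  case 0
  then show ?case
    by (auto intro: has_derivative_continuous_on)
next
  case (Suc k)
  obtain f' where "\<And>x. x \<in> S \<Longrightarrow> (f has_derivative f' x) (at x within S)"
    and "\<And>v. Ck_on (Suc k) (\<lambda>x. f' x v) S"
    using Suc.prems by (rule Ck_on_SucE) blast
  then show ?case
    using Suc.IH by (intro Ck_on_SucI) auto
qed

lemma Ck_on_const: "Ck_on k (\<lambda>x. c) S"
proof (induction k arbitrary: c)
  case (Suc k)
  show ?case
    by (rule Ck_on_SucI[where f' = "\<lambda>x v. 0"]) (auto intro: Suc.IH)
qed simp

lemma Ck_on_add:
  assumes "Ck_on k f S" "Ck_on k g S"
  shows "Ck_on k (\<lambda>x. f x + g x) S"
  using assms
proof (induction k arbitrary: f g)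
  case 0
  then show ?case by (auto intro: continuous_intros)
next
  case (Suc k)
  obtain f' where f': "\<And>x. x \<in> S \<Longrightarrow> (f has_derivative f' x) (at x within S)"
    "\<And>v. Ck_on k (\<lambda>x. f' x v) S"
    using Suc.prems(1) by (rule Ck_on_SucE) blast
  obtain g' where g': "\<And>x. x \<in> S \<Longrightarrow> (g has_derivative g' x) (at x within S)"
    "\<And>v. Ck_on k (\<lambda>x. g' x v) S"
    using Suc.prems(2) by (rule Ck_on_SucE) blast
  show ?case
    by (rule Ck_on_SucI[where f' = "\<lambda>x v. f' x v + g' x v"])
       (auto intro: f' g' Suc.IH has_derivative_add)
qed

lemma Ck_on_sum:
  assumes "\<And>i. i \<in> A \<Longrightarrow> Ck_on k (f i) S"
  shows "Ck_on k (\<lambda>x. \<Sum>i\<in>A. f i x) S"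
  using assms
  by (induction A rule: infinite_finite_induct) (auto intro: Ck_on_const Ck_on_add)

lemma Ck_on_bounded_linear:
  assumes "bounded_linear h" "Ck_on k f S"
  shows "Ck_on k (\<lambda>x. h (f x)) S"
  using assms(2)
proof (induction k arbitrary: f)
  case 0
  then show ?case using bounded_linear.continuous_on[OF assms(1)] by auto
next
  case (Suc k)
  obtain f' where "\<And>x. x \<in> S \<Longrightarrow> (f has_derivative f' x) (at x within S)"
    and "\<And>v. Ck_on k (\<lambda>x. f' x v) S"
    using Suc.prems by (rule Ck_on_SucE) blast
  then show ?case
    by (intro Ck_on_SucI[where f' = "\<lambda>x v. h (f' x v)"])
       (auto intro: Suc.IH bounded_linear.has_derivative[OF assms(1)])
qed

lemma Ck_on_scaleR:
  assumes "Ck_on k f S" "Ck_on k g S"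
  shows "Ck_on k (\<lambda>x. f x *\<^sub>R g x) S"
  using assms
proof (induction k arbitrary: f g)
  case 0
  then show ?case by (auto intro: continuous_intros)
next
  case (Suc k)
  obtain f' where f': "\<And>x. x \<in> S \<Longrightarrow> (f has_derivative f' x) (at x within S)"
    "\<And>v. Ck_on k (\<lambda>x. f' x v) S"
    using Suc.prems(1) by (rule Ck_on_SucE) blast
  obtain g' where g': "\<And>x. x \<in> S \<Longrightarrow> (g has_derivative g' x) (at x within S)"
    "\<And>v. Ck_on k (\<lambda>x. g' x v) S"
    using Suc.prems(2) by (rule Ck_on_SucE) blast
  show ?case
  proof (rule Ck_on_SucI)
    show "((\<lambda>x. f x *\<^sub>R g x) has_derivative (\<lambda>v. f x *\<^sub>R g' x v + f' x v *\<^sub>R g x)) (at x within S)"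
      if "x \<in> S" for x
      using f'(1) g'(1) that by (intro has_derivative_scaleR)
    show "Ck_on k (\<lambda>x. f x *\<^sub>R g' x v + f' x v *\<^sub>R g x) S" for v
      by (intro Ck_on_add Suc.IH f'(2) g'(2) Suc.prems[THEN Ck_on_Suc_imp])
  qed
qed

text \<open>The hypotheses control \<open>f'\<close> only in fixed directions, so the moving
  direction \<open>g' x v\<close> is expanded in the basis; its coordinates and the partial
  derivatives of \<open>f\<close> along \<open>g\<close> are then all of class \<open>k\<close>. The
  induction varies \<open>f\<close> and keeps \<open>g\<close>.\<close>

lemma Ck_on_compose:
  fixes f :: "'b::euclidean_space \<Rightarrow> 'c::real_normed_vector" and g :: "'a::euclidean_space \<Rightarrow> 'b"
  assumes "Ck_on k f T" "Ck_on k g S" "g ` S \<subseteq> T"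
  shows "Ck_on k (\<lambda>x. f (g x)) S"
  using assms(1,2)
proof (induction k arbitrary: f)
  case 0
  then show ?case
    using assms(3) by (auto intro: continuous_on_compose2)
next
  case (Suc k)
  obtain f' where f': "\<And>x. x \<in> T \<Longrightarrow> (f has_derivative f' x) (at x within T)"
    "\<And>v. Ck_on k (\<lambda>x. f' x v) T"
    using Suc.prems(1) by (rule Ck_on_SucE) blast
  obtain g' where g': "\<And>x. x \<in> S \<Longrightarrow> (g has_derivative g' x) (at x within S)"
    "\<And>v. Ck_on k (\<lambda>x. g' x v) S"
    using Suc.prems(2) by (rule Ck_on_SucE) blast
  show ?case
  proof (rule Ck_on_SucI[where f' = "\<lambda>x v. \<Sum>b\<in>Basis. (g' x v \<bullet> b) *\<^sub>R f' (g x) b"])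
    fix x assume x: "x \<in> S"
    have lin: "linear (f' (g x))"
      using f'(1)[of "g x"] x assms(3) by (auto intro: has_derivative_linear)
    have "f' (g x) w = (\<Sum>b\<in>Basis. (w \<bullet> b) *\<^sub>R f' (g x) b)" for w
      by (subst euclidean_representation[of w, symmetric])
         (simp only: linear_sum[OF lin] linear_cmul[OF lin])
    then have "(\<lambda>v. f' (g x) (g' x v)) = (\<lambda>v. \<Sum>b\<in>Basis. (g' x v \<bullet> b) *\<^sub>R f' (g x) b)"
      by (rule ext)
    with has_derivative_in_compose2[OF f'(1) assms(3) x g'(1)[OF x]]
    show "((\<lambda>x. f (g x)) has_derivative
        (\<lambda>v. \<Sum>b\<in>Basis. (g' x v \<bullet> b) *\<^sub>R f' (g x) b)) (at x within S)"
      by (rule back_subst)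
  next
    fix v
    show "Ck_on k (\<lambda>x. \<Sum>b\<in>Basis. (g' x v \<bullet> b) *\<^sub>R f' (g x) b) S"
      by (intro Ck_on_sum Ck_on_scaleR Ck_on_bounded_linear[OF bounded_linear_inner_left]
          Suc.IH[OF f'(2) Ck_on_Suc_imp[OF Suc.prems(2)]] g'(2))
  qed
qed

text \<open>The derivative is a product built from \<open>inverse\<close> itself, so the induction
  closes.\<close>

lemma Ck_on_inverse: "Ck_on k inverse {0::real<..}"
proof (induction k)
  case 0
  show ?case by (auto intro!: continuous_intros)
next
  case (Suc k)
  have "Ck_on k (\<lambda>x. - v *\<^sub>R (inverse x *\<^sub>R inverse x)) {0<..}" for v :: real
    by (intro Ck_on_bounded_linear[OF bounded_linear_scaleR_right] Ck_on_scaleR Suc)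
  then show ?case
    by (intro Ck_on_SucI[where f' = "\<lambda>x v. - v *\<^sub>R (inverse x *\<^sub>R inverse x)"])
       (auto intro!: derivative_eq_intros)
qed

lemma Ck_on_cong:
  assumes "\<And>x. x \<in> S \<Longrightarrow> f x = g x" "Ck_on k f S"
  shows "Ck_on k g S"
proof (cases k)
  case 0
  then show ?thesis
    using assms continuous_on_cong[of S S f g] by auto
next
  case (Suc j)
  obtain f' where f': "\<And>x. x \<in> S \<Longrightarrow> (f has_derivative f' x) (at x within S)"
    and "\<And>v. Ck_on j (\<lambda>x. f' x v) S"
    using assms(2) unfolding Suc by (rule Ck_on_SucE) blast
  then show ?thesis
    unfolding Suc using assms(1)
    by (intro Ck_on_SucI[where f' = f'] has_derivative_transform[OF _ _ f']) auto
qed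

lemma smooth_on_scaleR:
  "smooth_on f S \<Longrightarrow> smooth_on g S \<Longrightarrow> smooth_on (\<lambda>x. f x *\<^sub>R g x) S"
  by (simp add: smooth_on_def Ck_on_scaleR)

lemma smooth_on_compose:
  fixes f :: "'b::euclidean_space \<Rightarrow> 'c::real_normed_vector" and g :: "'a::euclidean_space \<Rightarrow> 'b"
  shows "smooth_on f T \<Longrightarrow> smooth_on g S \<Longrightarrow> g ` S \<subseteq> T \<Longrightarrow> smooth_on (\<lambda>x. f (g x)) S"
  unfolding smooth_on_def using Ck_on_compose by blast

lemma smooth_on_imp_continuous_on: "smooth_on f S \<Longrightarrow> continuous_on S f"
  unfolding smooth_on_def by (metis Ck_on.simps(1))

text \<open>Each order \<open>k\<close> may come with its own witness \<open>f'\<close>. Since no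
  point of \<open>S\<close> is isolated, the derivative within \<open>S\<close> is unique, so every
  witness evaluated at \<open>1\<close> agrees with \<open>vector_derivative\<close>.\<close>

lemma smooth_on_vector_derivative:
  fixes f :: "real \<Rightarrow> 'b::real_normed_vector"
  assumes "smooth_on f S" and ne: "\<And>x. x \<in> S \<Longrightarrow> at x within S \<noteq> bot"
  shows "x \<in> S \<Longrightarrow> (f has_vector_derivative vector_derivative f (at x within S)) (at x within S)"
    and "smooth_on (\<lambda>x. vector_derivative f (at x within S)) S"
proof -
  have *: "(x \<in> S \<longrightarrow> (f has_vector_derivative vector_derivative f (at x within S)) (at x within S))
      \<and> Ck_on k (\<lambda>x. vector_derivative f (at x within S)) S" for x k
  proof -
    have "Ck_on (Suc k) f S"
      using assms(1) unfolding smooth_on_def by blast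
    then obtain f' where f': "\<And>x. x \<in> S \<Longrightarrow> (f has_derivative f' x) (at x within S)"
      and Ck: "\<And>v. Ck_on k (\<lambda>x. f' x v) S"
      by (rule Ck_on_SucE) blast
    have D: "(f has_vector_derivative f' x 1) (at x within S)" if "x \<in> S" for x
    proof -
      have "f' x c = c *\<^sub>R f' x 1" for c
        using linear_cmul[OF has_derivative_linear[OF f'[OF that]], of c 1] by simp
      then have "f' x = (\<lambda>c. c *\<^sub>R f' x 1)"
        by (rule ext)
      with f'[OF that] show ?thesis
        unfolding has_vector_derivative_def by (rule back_subst[where P = "\<lambda>D. (f has_derivative D) _"])
    qed
    then have "f' x 1 = vector_derivative f (at x within S)" if "x \<in> S" for x
      using vector_derivative_within[OF ne] that by metis
    with D have "x \<in> S \<longrightarrow> (f has_vector_derivative vector_derivative f (at x within S)) (at x within S)"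
      by metis
    moreover have "Ck_on k (\<lambda>x. vector_derivative f (at x within S)) S"
      by (rule Ck_on_cong[OF _ Ck]) fact
    ultimately show ?thesis ..
  qed
  show "x \<in> S \<Longrightarrow> (f has_vector_derivative vector_derivative f (at x within S)) (at x within S)"
    using * by blast
  show "smooth_on (\<lambda>x. vector_derivative f (at x within S)) S"
    using * unfolding smooth_on_def by blast
qed

subsection \<open>Calculus on intervals\<close>

lemma at_within_interval_neq_bot:
  fixes I :: "real set"
  assumes "is_interval I" "a \<in> I" "b \<in> I" "a < b" "x \<in> I"
  shows "at x within I \<noteq> bot"
  using connected_imp_perfect[of I x] assms
  by (auto simp: trivial_limit_within is_interval_connected)

text \<open>An inverse-function argument for a continuous \<open>\<theta>\<close>: with the
  Caratheodory slope \<open>h\<close> of \<open>g\<close>, the difference quotient of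
  \<open>g \<circ> \<theta>\<close> is \<open>h (\<theta> z)\<close> times that of
  \<open>\<theta>\<close>, and \<open>h (\<theta> z)\<close> tends to \<open>d \<noteq> 0\<close>,
  so it can be divided out.\<close>

lemma has_real_derivative_lift:
  fixes g \<theta> :: "real \<Rightarrow> real"
  assumes cont: "continuous (at x within S) \<theta>" and sub: "\<theta> ` S \<subseteq> T"
    and g: "(g has_real_derivative d) (at (\<theta> x) within T)" and "d \<noteq> 0"
    and comp: "((\<lambda>z. g (\<theta> z)) has_real_derivative e) (at x within S)"
  shows "(\<theta> has_real_derivative e / d) (at x within S)"
proof -
  obtain h where h: "\<And>y. g y - g (\<theta> x) = h y * (y - \<theta> x)" "h (\<theta> x) = d"
    and conth: "continuous (at (\<theta> x) within T) h"
    using g unfolding DERIV_caratheodory_within by metis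
  have "continuous (at x within S) (\<lambda>z. h (\<theta> z))"
    using continuous_within_compose2[OF cont continuous_within_subset[OF conth sub]] .
  then have lim: "((\<lambda>z. h (\<theta> z)) \<longlongrightarrow> d) (at x within S)"
    using h(2) by (simp add: continuous_within)
  have quot: "((\<lambda>z. (g (\<theta> z) - g (\<theta> x)) / (z - x) / h (\<theta> z)) \<longlongrightarrow> e / d) (at x within S)"
    using comp unfolding has_field_derivative_iff by (rule tendsto_divide[OF _ lim \<open>d \<noteq> 0\<close>])
  have "\<forall>\<^sub>F z in at x within S. h (\<theta> z) \<noteq> 0"
    using tendsto_imp_eventually_ne[OF lim \<open>d \<noteq> 0\<close>] .
  then have "\<forall>\<^sub>F z in at x within S.
      (g (\<theta> z) - g (\<theta> x)) / (z - x) / h (\<theta> z) = (\<theta> z - \<theta> x) / (z - x)"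
    by eventually_elim (simp add: h(1))
  then show ?thesis
    unfolding has_field_derivative_iff using quot by (simp cong: tendsto_cong)
qed

text \<open>The fundamental theorem on a compact interval is transferred to \<open>I\<close>, which
  may be open, half-open or unbounded, by means of a compact subinterval that contains
  \<open>c\<close> and coincides with \<open>I\<close> near \<open>x\<close>.\<close>

lemma has_antiderivative_interval:
  fixes f :: "real \<Rightarrow> real"
  assumes I: "is_interval I" "c \<in> I" and f: "continuous_on I f" and x: "x \<in> I"
  shows "((\<lambda>u. LBINT y=ereal c..ereal u. f y) has_real_derivative f x) (at x within I)"
proof -
  \<comment> \<open>\<open>a\<close> and \<open>b\<close> lie strictly beyond \<open>x\<close> on
    each side where \<open>I\<close> has points, and equal \<open>x\<close> on a side where
    \<open>I\<close> stops.\<close>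
  define a where "a = (if \<exists>y\<in>I. y < x then SOME y. y \<in> I \<and> y < x else x)"
  define b where "b = (if \<exists>y\<in>I. x < y then SOME y. y \<in> I \<and> x < y else x)"
  have a: "a \<in> I" "a \<le> x" "(\<exists>y\<in>I. y < x) \<Longrightarrow> a < x"
    using someI_ex[of "\<lambda>y. y \<in> I \<and> y < x"] x unfolding a_def
    by (auto simp: Bex_def intro: less_imp_le)
  have b: "b \<in> I" "x \<le> b" "(\<exists>y\<in>I. x < y) \<Longrightarrow> x < b"
    using someI_ex[of "\<lambda>y. y \<in> I \<and> x < y"] x unfolding b_def
    by (auto simp: Bex_def intro: less_imp_le)
  define p q where "p = min a c" and "q = max b c"
  have pq: "p \<in> I" "q \<in> I" "p \<le> c" "c \<le> q" "p \<le> x" "x \<le> q"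
    using a b I by (auto simp: p_def q_def min_def max_def)
  have sub: "{p..q} \<subseteq> I"
    using mem_is_interval_1_I[OF I(1) pq(1,2)] by auto
  have "((\<lambda>u. LBINT y=ereal c..ereal u. f y) has_vector_derivative f x) (at x within {p..q})"
    using pq continuous_on_subset[OF f sub] by (intro interval_integral_FTC2) auto
  moreover have "at x within {p..q} = at x within I"
  proof (rule at_within_nhd)
    \<comment> \<open>\<open>V\<close> is cut off only on the sides where \<open>I\<close> continues
      past \<open>x\<close>; there \<open>p\<close> or \<open>q\<close> lies strictly beyond
      \<open>x\<close>, so \<open>V\<close> stays a neighbourhood of \<open>x\<close>.\<close>
    define V where "V = (if \<exists>y\<in>I. y < x then {p<..} else UNIV) \<inter> (if \<exists>y\<in>I. x < y then {..<q} else UNIV)"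
    have "(\<exists>y\<in>I. y < x) \<Longrightarrow> p < x" "(\<exists>y\<in>I. x < y) \<Longrightarrow> x < q"
      using a(3) b(3) by (simp_all add: p_def q_def min_less_iff_disj less_max_iff_disj)
    then show "x \<in> V" "open V"
      by (auto simp: V_def)
    have "p \<le> y \<and> y \<le> q" if y: "y \<in> I" "y \<in> V" "y \<noteq> x" for y
    proof (cases "y < x")
      case True
      then have "\<exists>y\<in>I. y < x" using y(1) by blast
      then have "p < y" using y(2) by (simp add: V_def)
      then show ?thesis using True pq by linarith
    next
      case False
      then have "x < y" using y(3) by simp
      then have "\<exists>y\<in>I. x < y" using y(1) by blast
      then have "y < q" using y(2) by (simp add: V_def)
      then show ?thesis using \<open>x < y\<close> pq by linarith
    qed
    then show "{p..q} \<inter> V - {x} = I \<inter> V - {x}"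
      using sub by auto
  qed
  ultimately show ?thesis
    by (simp add: has_real_derivative_iff_has_vector_derivative)
qed

lemma strict_mono_on_interval:
  fixes f :: "real \<Rightarrow> real"
  assumes I: "is_interval I"
    and f: "\<And>x. x \<in> I \<Longrightarrow> (f has_real_derivative f' x) (at x within I)"
    and pos: "\<And>x. x \<in> I \<Longrightarrow> 0 < f' x"
  shows "strict_mono_on I f"
proof (rule strict_mono_onI)
  fix a b assume ab: "a \<in> I" "b \<in> I" "a < b"
  have sub: "{a..b} \<subseteq> I"
    using mem_is_interval_1_I[OF I ab(1,2)] by auto
  have "(f has_derivative (\<lambda>v. f' x * v)) (at x within {a..b})" if "a \<le> x" "x \<le> b" for x
    using DERIV_subset[OF f sub] sub that unfolding has_field_derivative_def by auto
  from mvt_simple[OF \<open>a < b\<close> this]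
  obtain x where x: "x \<in> {a<..<b}" "f b - f a = f' x * (b - a)" by blast
  have "x \<in> I"
    using sub x(1) by auto
  then have "0 < f' x * (b - a)"
    using pos \<open>a < b\<close> by simp
  then show "f a < f b"
    using x(2) by simp
qed

text \<open>This is \<open>has_real_derivative_lift\<close> with the inverse as
  \<open>\<theta>\<close> and \<open>f\<close> as \<open>g\<close>, since \<open>f\<close> after its
  inverse is the identity. The inverse is continuous because a continuous injection on an interval
  is a homeomorphism onto its image.\<close>

lemma has_real_derivative_inv_into:
  fixes f :: "real \<Rightarrow> real"
  assumes I: "is_interval I"
    and f: "\<And>x. x \<in> I \<Longrightarrow> (f has_real_derivative f' x) (at x within I)"
    and inj: "inj_on f I" and x: "x \<in> I" "f' x \<noteq> 0"
  shows "(inv_into I f has_real_derivative 1 / f' x) (at (f x) within f ` I)"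
proof (rule has_real_derivative_lift)
  have "continuous_on I f"
    using f by (intro DERIV_continuous_on)
  then obtain g where g: "homeomorphism I (f ` I) f g"
    using injective_into_1d_eq_homeomorphism[of I f] inj I
    by (auto simp: is_interval_path_connected_1)
  have "continuous_on (f ` I) (inv_into I f)"
    using homeomorphism_cont2[OF g]
    by (rule continuous_on_eq) (auto simp: homeomorphism_apply1[OF g] inj)
  then show "continuous (at (f x) within f ` I) (inv_into I f)"
    using x by (simp add: continuous_on_eq_continuous_within)
  show "inv_into I f ` f ` I \<subseteq> I"
    by (auto simp: inj)
  show "(f has_real_derivative f' x) (at (inv_into I f (f x)) within I)"
    using f x inj by simp
  show "((\<lambda>z. f (inv_into I f z)) has_real_derivative 1) (at (f x) within f ` I)"
    using x by (intro has_field_derivative_transform_within[OF DERIV_ident zero_less_one])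
      (auto simp: f_inv_into_f)
qed (use x in auto)

subsection \<open>The bracket\<close>

lemma bounded_linear_bracket: "bounded_linear (bracket a)"
  unfolding bracket_def
  by (intro bounded_linear_sub bounded_linear_const_mult bounded_linear_vec_nth)

lemma continuous_on_bracket:
  "continuous_on S f \<Longrightarrow> continuous_on S g \<Longrightarrow> continuous_on S (\<lambda>x. bracket (f x) (g x))"
  unfolding bracket_def by (intro continuous_intros)

lemma has_real_derivative_bracket:
  "(f has_vector_derivative f') (at x within S) \<Longrightarrow>
    ((\<lambda>x. bracket a (f x)) has_real_derivative bracket a f') (at x within S)"
  unfolding has_real_derivative_iff_has_vector_derivative
  by (rule bounded_linear.has_vector_derivative[OF bounded_linear_bracket])

lemma bracket_scaleR_right: "bracket a (c *\<^sub>R b) = c * bracket a b"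
  by (simp add: bracket_def algebra_simps)

subsection \<open>Counter-clockwise parametrizations\<close>

lemma ccw_has_vector_derivative:
  assumes "ccw_parametrization S \<phi>"
  shows "(\<phi> has_vector_derivative vector_derivative \<phi> (at t)) (at t)"
  using assms smooth_on_vector_derivative(1)[of \<phi> UNIV t] by (simp add: ccw_parametrization_def)

lemma ccw_continuous_bracket:
  assumes "ccw_parametrization S \<phi>"
  shows "continuous_on UNIV (\<lambda>t. bracket (\<phi> t) (vector_derivative \<phi> (at t)))"
  using assms smooth_on_vector_derivative(2)[of \<phi> UNIV]
  by (intro continuous_on_bracket smooth_on_imp_continuous_on) (auto simp: ccw_parametrization_def)

lemma sector_param_has_derivative:
  assumes "ccw_parametrization S \<phi>"
  shows "(sector_param \<phi> t0 has_real_derivative bracket (\<phi> t) (vector_derivative \<phi> (at t))) (at t)"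
  using has_antiderivative_interval[OF _ _ ccw_continuous_bracket[OF assms], of t0 t]
  by (simp add: sector_param_def[abs_def])

text \<open>Positivity alone would not make the sector parameter unbounded. The bracket is
  continuous and periodic, so its minimum over one period is a positive lower bound
  everywhere.\<close>

lemma ccw_bracket_bounded_below:
  assumes "ccw_parametrization S \<phi>"
  obtains m where "m > 0" "\<And>t. m \<le> bracket (\<phi> t) (vector_derivative \<phi> (at t))"
proof -
  define B where "B t = bracket (\<phi> t) (vector_derivative \<phi> (at t))" for t
  obtain T where T: "T > 0" "\<And>t. \<phi> (t + T) = \<phi> t" and pos: "\<And>t. B t > 0"
    using assms by (auto simp: ccw_parametrization_def B_def)
  have "vector_derivative \<phi> (at (t + T)) = vector_derivative \<phi> (at t)" for t
  proof -
    have "((\<lambda>t. t + T) has_vector_derivative 1) (at t)"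
      by (auto intro!: derivative_eq_intros)
    from vector_diff_chain_at[OF this ccw_has_vector_derivative[OF assms]]
    have "(\<phi> has_vector_derivative vector_derivative \<phi> (at (t + T))) (at t)"
      using T(2) by (simp add: o_def)
    then show ?thesis by (simp add: vector_derivative_at)
  qed
  then interpret periodic_fun_simple B T
    by unfold_locales (simp add: B_def T)
  have "continuous_on {0..T} B"
    using continuous_on_subset[OF ccw_continuous_bracket[OF assms]] by (simp add: B_def[abs_def])
  then obtain c where c: "\<And>t. t \<in> {0..T} \<Longrightarrow> B c \<le> B t"
    using continuous_attains_inf[of "{0..T}" B] T(1) by fastforce
  have "B c \<le> B t" for t
  proof -
    \<comment> \<open>Subtracting \<open>\<lfloor>t / T\<rfloor>\<close> periods moves
      \<open>t\<close> into the first period.\<close>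
    have "B (t - of_int \<lfloor>t / T\<rfloor> * T) = B t"
      by (rule minus_of_int)
    moreover have "t - of_int \<lfloor>t / T\<rfloor> * T \<in> {0..T}"
      using floor_divide_lower[OF T(1), of t] floor_divide_upper[OF T(1), of t]
      by (auto simp: algebra_simps)
    ultimately show ?thesis using c by metis
  qed
  then show thesis
    using that[of "B c"] pos by (simp add: B_def)
qed

text \<open>Bijectivity makes \<open>inv\<close> in \<open>reparam_by_sector\<close> a genuine
  inverse. Injectivity follows from the positive derivative, surjectivity from at least linear
  growth and the intermediate value theorem.\<close>

lemma bij_sector_param:
  assumes "ccw_parametrization S \<phi>"
  shows "bij (sector_param \<phi> t0)"
proof (rule bijI)
  let ?U = "sector_param \<phi> t0"
  note D = sector_param_has_derivative[OF assms, of t0]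
  have "strict_mono_on UNIV ?U"
    by (rule strict_mono_on_interval[OF _ D]) (use assms in \<open>auto simp: ccw_parametrization_def\<close>)
  then show "inj ?U"
    by (rule strict_mono_on_imp_inj_on)
  obtain m where m: "m > 0" "\<And>t. m \<le> bracket (\<phi> t) (vector_derivative \<phi> (at t))"
    using ccw_bracket_bounded_below[OF assms] by blast
  have le: "?U a - m * a \<le> ?U b - m * b" if "a \<le> b" for a b
  proof (rule DERIV_nonneg_imp_nondecreasing[OF that])
    fix t
    show "\<exists>y. ((\<lambda>t. ?U t - m * t) has_real_derivative y) (at t) \<and> 0 \<le> y"
      by (rule exI[of _ "bracket (\<phi> t) (vector_derivative \<phi> (at t)) - m"])
         (auto intro!: derivative_eq_intros D simp: m)
  qed
  show "surj ?U"
    unfolding surj_def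
  proof
    fix y
    \<comment> \<open>Growth at rate at least \<open>m\<close> over a distance \<open>x\<close> on
      either side of \<open>0\<close> covers the gap between \<open>?U 0\<close> and
      \<open>y\<close>.\<close>
    define x where "x = \<bar>y - ?U 0\<bar> / m"
    have x: "0 \<le> x" "m * x = \<bar>y - ?U 0\<bar>"
      using m(1) by (auto simp: x_def)
    have "?U (- x) \<le> y" "y \<le> ?U x"
      using le[of "- x" 0] le[of 0 x] x by simp_all
    moreover have "continuous_on {- x..x} ?U"
      by (rule DERIV_continuous_on[OF has_field_derivative_at_within[OF D]])
    moreover have "- x \<le> x"
      using x(1) by simp
    ultimately obtain z where "?U z = y"
      using IVT'[of ?U "- x" y x] by blast
    then have "y = ?U z" by simp
    then show "\<exists>z. y = ?U z"
      by (rule exI)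
  qed
qed

text \<open>The inverse of the sector parameter has derivative \<open>1 / [\<phi>, \<phi>']\<close>,
  so the chain rule gives \<open>w = \<phi>' / [\<phi>, \<phi>']\<close>, whence the normalization
  \<open>[\<psi>, \<psi>'] = 1\<close>.\<close>

lemma reparam_by_sector_has_derivative:
  assumes "ccw_parametrization S \<phi>"
  obtains w where "(reparam_by_sector \<phi> t0 has_vector_derivative w) (at v)"
    and "bracket (reparam_by_sector \<phi> t0 v) w = 1"
proof -
  let ?U = "sector_param \<phi> t0"
  define t where "t = inv ?U v"
  have v: "v = ?U t"
    using bij_is_surj[OF bij_sector_param[OF assms]] by (simp add: t_def surj_f_inv_f)
  let ?d = "vector_derivative \<phi> (at t)"
  have pos: "bracket (\<phi> t) ?d > 0"
    using assms by (simp add: ccw_parametrization_def)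
  have "(inv ?U has_real_derivative 1 / bracket (\<phi> t) ?d) (at v)"
    using has_real_derivative_inv_into[of UNIV ?U, OF _ sector_param_has_derivative[OF assms], of t]
      bij_sector_param[OF assms, of t0] pos v
    by (auto simp: bij_def)
  then have "(reparam_by_sector \<phi> t0 has_vector_derivative (1 / bracket (\<phi> t) ?d) *\<^sub>R ?d) (at v)"
    unfolding reparam_by_sector_def
    by (intro vector_diff_chain_at)
       (use ccw_has_vector_derivative[OF assms] in
         \<open>auto simp: has_real_derivative_iff_has_vector_derivative t_def\<close>)
  moreover have "bracket (reparam_by_sector \<phi> t0 v) ((1 / bracket (\<phi> t) ?d) *\<^sub>R ?d) = 1"
    using pos by (simp add: bracket_scaleR_right reparam_by_sector_def t_def)
  ultimately show thesis by (rule that)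
qed

subsection \<open>The polar parametrization of the unit circle\<close>

definition dir :: "real \<Rightarrow> real ^ 2" where
  "dir t = cos t *\<^sub>R axis 1 1 + sin t *\<^sub>R axis 2 1"

lemma dir_nth [simp]: "dir t $ 1 = cos t" "dir t $ 2 = sin t"
  by (simp_all add: dir_def axis_def)

lemma dir_nonzero: "dir t \<noteq> 0"
proof
  assume "dir t = 0"
  then have "cos t = 0" "sin t = 0"
    by (metis dir_nth zero_index)+
  then show False using sin_zero_norm_cos_one by force
qed

lemma dir_has_vector_derivative: "(dir has_vector_derivative dir (t + pi / 2)) (at t within S)"
  unfolding dir_def[abs_def] by (auto intro!: derivative_eq_intros simp: cos_add sin_add)

lemma smooth_on_dir: "smooth_on dir UNIV"
proof -
  \<comment> \<open>Differentiation shifts the angle by \<open>pi / 2\<close>, so the induction has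
    to treat all shifts \<open>c\<close> at once.\<close>
  have "Ck_on k (\<lambda>t. dir (t + c)) UNIV" for k c
  proof (induction k arbitrary: c)
    case 0
    show ?case by (auto simp: dir_def intro!: continuous_intros)
  next
    case (Suc k)
    show ?case
    proof (rule Ck_on_SucI[where f' = "\<lambda>t v. v *\<^sub>R dir (t + (c + pi / 2))"])
      show "Ck_on k (\<lambda>t. v *\<^sub>R dir (t + (c + pi / 2))) UNIV" for v
        by (rule Ck_on_bounded_linear[OF bounded_linear_scaleR_right Suc])
      have "((\<lambda>t. t + c) has_vector_derivative 1) (at t)" for t
        by (auto intro!: derivative_eq_intros)
      from vector_diff_chain_at[OF this dir_has_vector_derivative]
      show "((\<lambda>t. dir (t + c)) has_derivative (\<lambda>v. v *\<^sub>R dir (t + (c + pi / 2)))) (at t)" for t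
        by (simp add: o_def has_vector_derivative_def add.assoc)
    qed
  qed
  from this[of _ 0] show ?thesis by (simp add: smooth_on_def)
qed

locale smooth_gauge =
  fixes F :: "real ^ 2 \<Rightarrow> real"
  assumes gauge: "plane_gauge F" and smooth: "smooth_on F (- {0})"
begin

lemma F_pos: "x \<noteq> 0 \<Longrightarrow> F x > 0"
  using gauge unfolding plane_gauge_def by (metis less_eq_real_def)

lemma F_zero: "F 0 = 0"
  using gauge by (simp add: plane_gauge_def)

lemma F_scaleR: "l > 0 \<Longrightarrow> F (l *\<^sub>R x) = l * F x"
  using gauge unfolding plane_gauge_def by blast

lemma smooth_on_inverse_F:
  fixes f :: "real \<Rightarrow> real ^ 2"
  assumes "smooth_on f S" "\<And>t. t \<in> S \<Longrightarrow> f t \<noteq> 0"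
  shows "smooth_on (\<lambda>t. inverse (F (f t))) S"
proof (rule smooth_on_compose[of inverse "{0<..}"])
  show "smooth_on inverse {0::real<..}"
    by (simp add: smooth_on_def Ck_on_inverse)
  show "smooth_on (\<lambda>t. F (f t)) S"
    using assms by (intro smooth_on_compose[OF smooth]) auto
qed (use assms F_pos in auto)

definition polar :: "real \<Rightarrow> real ^ 2" where
  "polar t = inverse (F (dir t)) *\<^sub>R dir t"

lemma polar_nth: "polar t $ 1 = inverse (F (dir t)) * cos t" "polar t $ 2 = inverse (F (dir t)) * sin t"
  by (simp_all add: polar_def)

lemma F_polar: "F (polar t) = 1"
  using F_pos[OF dir_nonzero, of t] by (simp add: polar_def F_scaleR)

text \<open>Positive homogeneity forces \<open>r = 1 / F (dir t)\<close>: a ray from the origin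
  meets the unit circle only once.\<close>

lemma polar_eqI:
  assumes "F x = 1" "x = r *\<^sub>R dir t" "r > 0"
  shows "polar t = x"
proof -
  have "r * F (dir t) = 1"
    using assms by (simp add: F_scaleR)
  then have "inverse (F (dir t)) = r"
    using inverse_unique mult.commute by metis
  then show ?thesis
    using assms(2) by (simp add: polar_def)
qed

lemma smooth_on_inverse_F_dir: "smooth_on (\<lambda>t. inverse (F (dir t))) UNIV"
  by (rule smooth_on_inverse_F[OF smooth_on_dir dir_nonzero])

text \<open>The radial term \<open>r' *\<^sub>R dir t\<close> is parallel to \<open>polar t\<close>
  and drops out of the bracket. What remains is \<open>r\<^sup>2\<close> times the bracket of
  \<open>dir t\<close> with its quarter turn, which is 1.\<close>

lemma bracket_polar_pos: "bracket (polar t) (vector_derivative polar (at t)) > 0"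
proof -
  define r r' where "r = inverse (F (dir t))"
    and "r' = vector_derivative (\<lambda>t. inverse (F (dir t))) (at t)"
  have "((\<lambda>t. inverse (F (dir t))) has_real_derivative r') (at t)"
    using smooth_on_vector_derivative(1)[OF smooth_on_inverse_F_dir, of t]
    by (simp add: has_real_derivative_iff_has_vector_derivative r'_def)
  from has_vector_derivative_scaleR[OF this dir_has_vector_derivative]
  have "(polar has_vector_derivative r *\<^sub>R dir (t + pi / 2) + r' *\<^sub>R dir t) (at t)"
    unfolding polar_def[abs_def] r_def .
  then have "vector_derivative polar (at t) = r *\<^sub>R dir (t + pi / 2) + r' *\<^sub>R dir t"
    by (rule vector_derivative_at)
  then have "bracket (polar t) (vector_derivative polar (at t)) = r\<^sup>2 * ((sin t)\<^sup>2 + (cos t)\<^sup>2)"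
    by (simp add: bracket_def polar_nth r_def[symmetric] cos_add sin_add power2_eq_square algebra_simps
        del: sin_cos_squared_add sin_cos_squared_add2 sin_cos_squared_add3)
  then show ?thesis
    using F_pos[OF dir_nonzero, of t] by (simp add: r_def)
qed

lemma ccw_polar: "ccw_parametrization (unit_circle F) polar"
  unfolding ccw_parametrization_def
proof (intro conjI exI[of _ "2 * pi"])
  show "\<forall>t. bracket (polar t) (vector_derivative polar (at t)) > 0"
    using bracket_polar_pos by blast
  show "smooth_on polar UNIV"
    unfolding polar_def[abs_def]
    by (rule smooth_on_scaleR[OF smooth_on_inverse_F_dir smooth_on_dir])
  show "range polar = unit_circle F"
  proof (intro equalityI subsetI)
    fix x assume "x \<in> unit_circle F"
    then have x: "F x = 1" by (simp add: unit_circle_def)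
    then have "x \<noteq> 0"
      using F_zero by auto
    \<comment> \<open>The plane is identified with the complex numbers so that \<open>Arg z\<close>
      supplies a polar angle of \<open>x\<close>.\<close>
    define z where "z = Complex (x $ 1) (x $ 2)"
    have "z \<noteq> 0"
      using \<open>x \<noteq> 0\<close> by (auto simp: z_def complex_eq_iff vec_eq_iff forall_2)
    have "z = rcis (cmod z) (Arg z)"
      by (simp add: rcis_cmod_Arg)
    then have "x = cmod z *\<^sub>R dir (Arg z)"
      by (auto simp: vec_eq_iff forall_2 z_def complex_eq_iff)
    then have "polar (Arg z) = x"
      using x \<open>z \<noteq> 0\<close> by (intro polar_eqI) auto
    then show "x \<in> range polar" by blast
  qed (auto simp: unit_circle_def F_polar)
  show "\<forall>t. polar (t + 2 * pi) = polar t"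
    by (simp add: polar_def dir_def)
  show "inj_on polar {0..<2 * pi}"
  proof (rule inj_onI)
    fix a b assume ab: "a \<in> {0..<2 * pi}" "b \<in> {0..<2 * pi}" and eq: "polar a = polar b"
    define p q where "p = inverse (F (dir a))" and "q = inverse (F (dir b))"
    have pq: "p > 0" "q > 0"
      using F_pos[OF dir_nonzero] by (auto simp: p_def q_def)
    have c: "p * cos a = q * cos b" and s: "p * sin a = q * sin b"
      using eq polar_nth unfolding p_def q_def by metis+
    \<comment> \<open>Adding the squares of both coordinates eliminates the angles, so the radii
      agree.\<close>
    have "p\<^sup>2 * ((sin a)\<^sup>2 + (cos a)\<^sup>2) = q\<^sup>2 * ((sin b)\<^sup>2 + (cos b)\<^sup>2)"
      using c s by (metis distrib_left power_mult_distrib)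
    then have "p = q"
      using pq by simp
    then have "sin a = sin b \<and> cos a = cos b"
      using c s pq by simp
    then obtain n :: int where n: "a = b + 2 * pi * n"
      using sin_cos_eq_iff by blast
    \<comment> \<open>Two points of a half-open interval of length \<open>2 * pi\<close> differ by
      less than that length, which leaves only \<open>n = 0\<close>.\<close>
    have "\<bar>2 * pi * n\<bar> < 2 * pi * 1"
      using ab n by auto
    then have "\<bar>real_of_int n\<bar> < 1"
      by (simp add: abs_mult)
    then show "a = b"
      using n by simp
  qed
qed simp

end

subsection \<open>Arc length, unit tangent and curvature\<close>

locale gauge_curve = smooth_gauge F for F +
  fixes I :: "real set" and \<gamma> :: "real \<Rightarrow> real ^ 2"
  assumes curve: "smooth_regular_curve I \<gamma>"
begin

abbreviation vel :: "real \<Rightarrow> real ^ 2" where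
  "vel \<tau> \<equiv> vector_derivative \<gamma> (at \<tau> within I)"

abbreviation acc :: "real \<Rightarrow> real ^ 2" where
  "acc \<tau> \<equiv> vector_derivative (\<lambda>t. vel t) (at \<tau> within I)"

text \<open>The vector \<open>d\<gamma>/ds\<close>, written in the original parameter so that it
  makes sense before an arc-length parameter is chosen.\<close>

definition unit_tangent :: "real \<Rightarrow> real ^ 2" where
  "unit_tangent \<tau> = inverse (F (vel \<tau>)) *\<^sub>R vel \<tau>"

lemma interval: "is_interval I" and nontrivial: "\<exists>a\<in>I. \<exists>b\<in>I. a < b"
  and smooth_\<gamma>: "smooth_on \<gamma> I" and vel_nonzero: "\<tau> \<in> I \<Longrightarrow> vel \<tau> \<noteq> 0"
  using curve by (auto simp: smooth_regular_curve_def)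

lemma F_vel_pos: "\<tau> \<in> I \<Longrightarrow> F (vel \<tau>) > 0"
  by (rule F_pos[OF vel_nonzero])

lemma at_within_I: "\<tau> \<in> I \<Longrightarrow> at \<tau> within I \<noteq> bot"
  using nontrivial at_within_interval_neq_bot[OF interval] by blast

lemma \<gamma>_has_vel: "\<tau> \<in> I \<Longrightarrow> (\<gamma> has_vector_derivative vel \<tau>) (at \<tau> within I)"
  by (rule smooth_on_vector_derivative(1)[OF smooth_\<gamma> at_within_I])

lemma smooth_vel: "smooth_on (\<lambda>\<tau>. vel \<tau>) I"
  by (rule smooth_on_vector_derivative(2)[OF smooth_\<gamma> at_within_I])

lemma vel_has_acc: "\<tau> \<in> I \<Longrightarrow> ((\<lambda>t. vel t) has_vector_derivative acc \<tau>) (at \<tau> within I)"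
  by (rule smooth_on_vector_derivative(1)[OF smooth_vel at_within_I])

lemma F_unit_tangent: "\<tau> \<in> I \<Longrightarrow> F (unit_tangent \<tau>) = 1"
  using F_vel_pos[of \<tau>] by (simp add: unit_tangent_def F_scaleR)

text \<open>The multiple of the velocity in the product rule drops out of the bracket. The tangent
  and its derivative each contribute a factor \<open>1 / F (vel \<tau>)\<close>, hence the
  square.\<close>

lemma unit_tangent_has_derivative:
  assumes "\<tau> \<in> I"
  obtains w where "(unit_tangent has_vector_derivative w) (at \<tau> within I)"
    and "bracket (unit_tangent \<tau>) w = bracket (vel \<tau>) (acc \<tau>) / (F (vel \<tau>))\<^sup>2"
proof
  let ?r = "\<lambda>t. inverse (F (vel t))"
  let ?r' = "vector_derivative ?r (at \<tau> within I)"
  have "(?r has_real_derivative ?r') (at \<tau> within I)"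
    using smooth_on_vector_derivative(1)[OF smooth_on_inverse_F[OF smooth_vel vel_nonzero] at_within_I, of \<tau>] assms
    by (simp add: has_real_derivative_iff_has_vector_derivative)
  from has_vector_derivative_scaleR[OF this vel_has_acc[OF assms]]
  show "(unit_tangent has_vector_derivative ?r \<tau> *\<^sub>R acc \<tau> + ?r' *\<^sub>R vel \<tau>) (at \<tau> within I)"
    unfolding unit_tangent_def[abs_def] .
  show "bracket (unit_tangent \<tau>) (?r \<tau> *\<^sub>R acc \<tau> + ?r' *\<^sub>R vel \<tau>)
      = bracket (vel \<tau>) (acc \<tau>) / (F (vel \<tau>))\<^sup>2"
    using F_vel_pos[OF assms]
    by (simp add: unit_tangent_def bracket_def field_simps power2_eq_square)
qed

lemma continuous_on_F_vel: "continuous_on I (\<lambda>\<tau>. F (vel \<tau>))"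
  using vel_nonzero
  by (intro smooth_on_imp_continuous_on smooth_on_compose[OF smooth smooth_vel]) auto

lemma arc_length_param_exists: obtains s where "arc_length_param F I \<gamma> s"
proof -
  obtain c where "c \<in> I" using nontrivial by blast
  from has_antiderivative_interval[OF interval this continuous_on_F_vel]
  show thesis by (intro that) (auto simp: arc_length_param_def)
qed

section \<open>Reparametrization and tangent lifts for an arbitrary arc-length parameter\<close>

context
  fixes s :: "real \<Rightarrow> real"
  assumes s: "arc_length_param F I \<gamma> s"
begin

lemma arc_length_has_derivative:
  "\<tau> \<in> I \<Longrightarrow> (s has_real_derivative F (vel \<tau>)) (at \<tau> within I)"
  using s by (auto simp: arc_length_param_def)

lemma arc_length_inj: "inj_on s I"
  using strict_mono_on_interval[OF interval arc_length_has_derivative F_vel_pos]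
  by (rule strict_mono_on_imp_inj_on)

lemma arc_length_interval: "is_interval (s ` I)"
  using connected_continuous_image[OF DERIV_continuous_on[OF arc_length_has_derivative]] interval
  by (simp add: is_interval_connected_1)

text \<open>This makes derivatives within the arc-length interval unique, also at its end points, so
  that \<open>vector_derivative\<close> can be evaluated there.\<close>

lemma at_within_arc_length:
  assumes "\<tau> \<in> I"
  shows "at (s \<tau>) within s ` I \<noteq> bot"
proof -
  obtain a b where ab: "a \<in> I" "b \<in> I" "a < b" using nontrivial by blast
  then have "s a < s b"
    using strict_mono_on_interval[OF interval arc_length_has_derivative F_vel_pos]
    by (rule strict_mono_onD[rotated])
  then show ?thesis
    using at_within_interval_neq_bot[OF arc_length_interval] ab assms by blast
qed

lemma inv_arc_length: "\<tau> \<in> I \<Longrightarrow> inv_into I s (s \<tau>) = \<tau>"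
  by (rule inv_into_f_f[OF arc_length_inj])

lemma inv_arc_length_has_derivative:
  assumes "\<tau> \<in> I"
  shows "(inv_into I s has_vector_derivative 1 / F (vel \<tau>)) (at (s \<tau>) within s ` I)"
  using has_real_derivative_inv_into[OF interval arc_length_has_derivative arc_length_inj assms]
    F_vel_pos[OF assms]
  by (simp add: has_real_derivative_iff_has_vector_derivative)

text \<open>The factor is \<open>d\<tau>/ds\<close>, the reciprocal of the speed. Applied to the
  unit tangent, it raises the square in the denominator to the cube.\<close>

lemma compose_inv_arc_length_has_derivative:
  assumes "\<tau> \<in> I" and f: "(f has_vector_derivative f') (at \<tau> within I)"
  shows "((f \<circ> inv_into I s) has_vector_derivative (1 / F (vel \<tau>)) *\<^sub>R f') (at (s \<tau>) within s ` I)"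
proof (rule vector_diff_chain_within[OF inv_arc_length_has_derivative[OF assms(1)]])
  show "(f has_vector_derivative f')
      (at (inv_into I s (s \<tau>)) within inv_into I s ` s ` I)"
    using f by (simp add: inv_arc_length assms(1) inv_into_image_cancel[OF arc_length_inj])
qed

lemma vector_derivative_wrt_arc_length:
  assumes "\<tau> \<in> I"
  shows "vector_derivative (\<gamma> \<circ> inv_into I s) (at (s \<tau>) within s ` I) = unit_tangent \<tau>"
  using vector_derivative_within[OF at_within_arc_length[OF assms]
      compose_inv_arc_length_has_derivative[OF assms \<gamma>_has_vel[OF assms]]]
  by (simp add: unit_tangent_def divide_inverse)

text \<open>The lift condition pulled back to the parameter of the curve, with the derivative along
  arc length already evaluated.\<close>

lemma tangent_lift_iff:
  "tangent_lift F I \<gamma> s \<phi> t0 u \<longleftrightarrow>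
     ccw_parametrization (unit_circle F) \<phi> \<and> continuous_on (s ` I) u \<and>
     (\<forall>\<tau>\<in>I. unit_tangent \<tau> = reparam_by_sector \<phi> t0 (u (s \<tau>)))"
  using s vector_derivative_wrt_arc_length unfolding tangent_lift_def by auto

lemma tangent_lift_exists: "\<exists>u. tangent_lift F I \<gamma> s polar t0 u"
proof -
  define W where "W \<sigma> = unit_tangent (inv_into I s \<sigma>)" for \<sigma>
  have W: "W (s \<tau>) = unit_tangent \<tau>" if "\<tau> \<in> I" for \<tau>
    using that by (simp add: W_def inv_arc_length)
  have contW: "continuous_on (s ` I) W"
    unfolding continuous_on_eq_continuous_within
  proof
    fix \<sigma> assume "\<sigma> \<in> s ` I"
    then obtain \<tau> where \<tau>: "\<tau> \<in> I" "\<sigma> = s \<tau>" by blast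
    obtain w where "(unit_tangent has_vector_derivative w) (at \<tau> within I)"
      by (rule unit_tangent_has_derivative[OF \<tau>(1)])
    from compose_inv_arc_length_has_derivative[OF \<tau>(1) this]
    have "(W has_vector_derivative (1 / F (vel \<tau>)) *\<^sub>R w) (at \<sigma> within s ` I)"
      by (simp add: \<tau>(2) W_def[abs_def] o_def)
    then show "continuous (at \<sigma> within s ` I) W"
      by (rule has_vector_derivative_continuous)
  qed
  \<comment> \<open>In complex form, a nowhere vanishing continuous function on a contractible set
    has a continuous logarithm, whose imaginary part is a continuous polar angle.\<close>
  define z where "z \<sigma> = Complex (W \<sigma> $ 1) (W \<sigma> $ 2)" for \<sigma>
  have "z \<sigma> \<noteq> 0" if "\<sigma> \<in> s ` I" for \<sigma>
  proof
    assume "z \<sigma> = 0"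
    then have "W \<sigma> = 0"
      by (auto simp: z_def complex_eq_iff vec_eq_iff forall_2)
    moreover have "F (W \<sigma>) = 1"
      using that F_unit_tangent by (auto simp: W)
    ultimately show False
      by (simp add: F_zero)
  qed
  moreover have "continuous_on (s ` I) z"
    unfolding z_def[abs_def] complex_eq by (intro continuous_intros contW)
  moreover have "contractible (s ` I)"
    using arc_length_interval by (simp add: is_interval_convex_1 convex_imp_contractible)
  ultimately obtain g where g: "continuous_on (s ` I) g"
    and exp: "\<And>\<sigma>. \<sigma> \<in> s ` I \<Longrightarrow> z \<sigma> = exp (g \<sigma>)"
    using continuous_logarithm_on_contractible by metis
  \<comment> \<open>The sector parameter of the polar angle; the inverse inside
    \<open>reparam_by_sector\<close> turns it back into the angle.\<close>
  define u where "u \<sigma> = sector_param polar t0 (Im (g \<sigma>))" for \<sigma>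
  have "continuous_on UNIV (sector_param polar t0)"
    by (rule DERIV_continuous_on[OF has_field_derivative_at_within[OF
            sector_param_has_derivative[OF ccw_polar]]])
  then have "continuous_on (s ` I) u"
    unfolding u_def[abs_def]
    by (rule continuous_on_compose2) (auto intro!: continuous_intros g)
  moreover have "unit_tangent \<tau> = reparam_by_sector polar t0 (u (s \<tau>))" if \<tau>: "\<tau> \<in> I" for \<tau>
  proof -
    have "z (s \<tau>) = exp (g (s \<tau>))"
      using exp \<tau> by blast
    then have "W (s \<tau>) = exp (Re (g (s \<tau>))) *\<^sub>R dir (Im (g (s \<tau>)))"
      by (simp add: z_def complex_eq_iff vec_eq_iff forall_2 Re_exp Im_exp)
    then have "unit_tangent \<tau> = exp (Re (g (s \<tau>))) *\<^sub>R dir (Im (g (s \<tau>)))"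
      by (simp add: W \<tau>)
    \<comment> \<open>The unit tangent lies on the unit circle and on the ray with this angle, hence
      is the polar point of the angle.\<close>
    then have "polar (Im (g (s \<tau>))) = unit_tangent \<tau>"
      by (rule polar_eqI[OF F_unit_tangent[OF \<tau>] _ exp_gt_zero])
    then show ?thesis
      using bij_is_inj[OF bij_sector_param[OF ccw_polar]]
      by (simp add: reparam_by_sector_def u_def)
  qed
  ultimately show ?thesis
    using tangent_lift_iff ccw_polar by blast
qed

lemma tangent_lift_has_derivative:
  assumes lift: "tangent_lift F I \<gamma> s \<phi> t0 u" and \<tau>: "\<tau> \<in> I"
  shows "(u has_real_derivative bracket (vel \<tau>) (acc \<tau>) / F (vel \<tau>) ^ 3) (at (s \<tau>) within s ` I)"
proof -
  let ?\<psi> = "reparam_by_sector \<phi> t0"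
  have ccw: "ccw_parametrization (unit_circle F) \<phi>" and cont: "continuous_on (s ` I) u"
    and u: "\<And>\<tau>. \<tau> \<in> I \<Longrightarrow> ?\<psi> (u (s \<tau>)) = unit_tangent \<tau>"
    using lift by (auto simp: tangent_lift_iff)
  obtain w where w: "(?\<psi> has_vector_derivative w) (at (u (s \<tau>)))"
    and "bracket (?\<psi> (u (s \<tau>))) w = 1"
    by (rule reparam_by_sector_has_derivative[OF ccw])
  \<comment> \<open>The first argument is frozen at \<open>unit_tangent \<tau>\<close>, which equals
    \<open>?\<psi> (u (s \<tau>))\<close>, so the normalized bracket is the derivative of this
    coordinate.\<close>
  with has_real_derivative_bracket[OF w, of "unit_tangent \<tau>"]
  have coord: "((\<lambda>v. bracket (unit_tangent \<tau>) (?\<psi> v)) has_real_derivative 1) (at (u (s \<tau>)))"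
    by (simp add: u \<tau>)
  obtain d where d: "(unit_tangent has_vector_derivative d) (at \<tau> within I)"
    and br: "bracket (unit_tangent \<tau>) d = bracket (vel \<tau>) (acc \<tau>) / (F (vel \<tau>))\<^sup>2"
    by (rule unit_tangent_has_derivative[OF \<tau>])
  from has_real_derivative_bracket[OF compose_inv_arc_length_has_derivative[OF \<tau> d],
      of "unit_tangent \<tau>"]
  have "((\<lambda>\<sigma>. bracket (unit_tangent \<tau>) (unit_tangent (inv_into I s \<sigma>))) has_real_derivative
      bracket (vel \<tau>) (acc \<tau>) / F (vel \<tau>) ^ 3) (at (s \<tau>) within s ` I)"
    by (simp add: bracket_scaleR_right br power3_eq_cube power2_eq_square mult.assoc)
  \<comment> \<open>The two functions agree on the whole image of \<open>I\<close>, so the radius 1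
    in the transfer is arbitrary.\<close>
  then have "((\<lambda>\<sigma>. bracket (unit_tangent \<tau>) (?\<psi> (u \<sigma>))) has_real_derivative
      bracket (vel \<tau>) (acc \<tau>) / F (vel \<tau>) ^ 3) (at (s \<tau>) within s ` I)"
    by (rule has_field_derivative_transform_within[OF _ zero_less_one])
       (use \<tau> in \<open>auto simp: u inv_arc_length\<close>)
  \<comment> \<open>The coordinate has slope 1 at \<open>u (s \<tau>)\<close>, so the derivative of
    its composite with \<open>u\<close> passes unchanged to \<open>u\<close>.\<close>
  from has_real_derivative_lift[OF _ _ coord _ this]
  show ?thesis
    using cont \<tau> by (simp add: continuous_on_eq_continuous_within)
qed

end

text \<open>Two things are required: some lift, supplied by the polar parametrization, and the
  derivative for every lift, whatever its arc-length parameter, circle parametrization and base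
  point.\<close>

lemma has_minkowski_curvature:
  assumes "\<tau> \<in> I"
  shows "has_minkowski_curvature F I \<gamma> \<tau> (bracket (vel \<tau>) (acc \<tau>) / F (vel \<tau>) ^ 3)"
proof -
  obtain s where "arc_length_param F I \<gamma> s"
    by (rule arc_length_param_exists)
  then have "\<exists>s \<phi> t0 u. tangent_lift F I \<gamma> s \<phi> t0 u"
    using tangent_lift_exists by blast
  moreover have "arc_length_param F I \<gamma> s" if "tangent_lift F I \<gamma> s \<phi> t0 u" for s \<phi> t0 u
    using that by (simp add: tangent_lift_def)
  ultimately show ?thesis
    using tangent_lift_has_derivative assms unfolding has_minkowski_curvature_def by blast
qed

end

theorem theorem3p1:
  fixes F :: "real ^ 2 \<Rightarrow> real" and I :: "real set"
    and \<gamma> \<gamma>' \<gamma>'' :: "real \<Rightarrow> real ^ 2" and \<tau> :: real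
  defines "\<gamma>' \<equiv> \<lambda>t. vector_derivative \<gamma> (at t within I)"
    and "\<gamma>'' \<equiv> \<lambda>t. vector_derivative \<gamma>' (at t within I)"
  assumes "plane_gauge F"
    and "smooth_on F (- {0})"
    and "smooth_plane_curve (unit_circle F)"
    and "strictly_convex_unit_circle F"
    and "smooth_regular_curve I \<gamma>"
    and "\<tau> \<in> I"
  shows "has_minkowski_curvature F I \<gamma> \<tau>
     ((\<gamma>' \<tau> $ 1 * \<gamma>'' \<tau> $ 2 - \<gamma>'' \<tau> $ 1 * \<gamma>' \<tau> $ 2) / (F (\<gamma>' \<tau>)) ^ 3)"
proof -
  interpret gauge_curve F I \<gamma>
    by unfold_locales fact+
  show ?thesis
    \<comment> \<open>The stated numerator is the bracket with the factors of its second product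
      swapped.\<close>
    using has_minkowski_curvature[OF \<open>\<tau> \<in> I\<close>]
    by (simp add: bracket_def \<gamma>'_def \<gamma>''_def mult.commute)
qed

end
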